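(* Let $S_0>0$, $\Delta S>0$, let $\hat S$ be the self-adjoint operator on $\ell^2(\mathbb Z)$ with $\hat S|n\rangle=(S_0+n\,\Delta S)|n\rangle$ (on its maximal domain), let $T_a|n\rangle=|n+a\rangle$ ($a\in\mathbb Z$) be the unitary shifts, and let $f:\mathbb R\to\mathbb R$ be Borel. For $\alpha\in\mathbb Z$ define the frequency operator $$\widehat\omega_\alpha:=f(\hat S)-T_{-\alpha}\,f(\hat S)\,T_\alpha.$$ Then for any $\alpha,\beta\in\mathbb Z$, $$\widehat\omega_{\alpha+\beta}=\widehat\omega_\alpha+T_{-\alpha}\,\widehat\omega_\beta\,T_\alpha.$$
   Context: $\{|n\rangle\}_{n\in\mathbb Z}$ is the canonical orthonormal basis of $\ell^2(\mathbb Z)$. $f(\hat S)$ is the self-adjoint operator given by the spectral calculus, so $f(\hat S)|n\rangle=f(S_0+n\,\Delta S)|n\rangle$.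
   Formalization: For unbounded f the two sides can have different natural domains, so literal equality fails; the identity is proved as equality on the domain of the right-hand side, which contains every |n⟩, together with equality of the closures of both sides. *)

theory Defs
  imports "HOL-Analysis.Analysis"
begin

section \<open>The Hilbert space of square-summable sequences on the integers\<close>

type_synonym vec = "int \<Rightarrow> complex"

definition ell2 :: "vec set" where
  "ell2 = {\<psi>. (\<lambda>n. (cmod (\<psi> n))\<^sup>2) summable_on UNIV}"

definition cip :: "vec \<Rightarrow> vec \<Rightarrow> complex" where
  "cip \<phi> \<psi> = (\<Sum>\<^sub>\<infinity>n. cnj (\<phi> n) * \<psi> n)"

definition nrm :: "vec \<Rightarrow> real" where
  "nrm \<psi> = sqrt (\<Sum>\<^sub>\<infinity>n. (cmod (\<psi> n))\<^sup>2)"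

definition ket :: "int \<Rightarrow> vec" where
  "ket n = (\<lambda>m. if m = n then 1 else 0)"


section \<open>Unbounded operators, represented by their graphs\<close>

text \<open>Sums, differences and products carry their natural domains: a sum or a difference is
  defined where both terms are, and a product \<open>A \<cdot> B\<close> on those \<open>\<psi>\<close> in the domain of \<open>B\<close> for
  which \<open>B \<psi>\<close> is in the domain of \<open>A\<close>.\<close>

type_synonym oper = "(vec \<times> vec) set"

definition op_add :: "oper \<Rightarrow> oper \<Rightarrow> oper" (infixl "\<oplus>" 65) where
  "A \<oplus> B = {(\<psi>, \<lambda>n. \<eta> n + \<zeta> n) | \<psi> \<eta> \<zeta>. (\<psi>, \<eta>) \<in> A \<and> (\<psi>, \<zeta>) \<in> B}"

definition op_diff :: "oper \<Rightarrow> oper \<Rightarrow> oper" (infixl "\<ominus>" 65) where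
  "A \<ominus> B = {(\<psi>, \<lambda>n. \<eta> n - \<zeta> n) | \<psi> \<eta> \<zeta>. (\<psi>, \<eta>) \<in> A \<and> (\<psi>, \<zeta>) \<in> B}"

definition op_mult :: "oper \<Rightarrow> oper \<Rightarrow> oper" (infixl "\<cdot>" 70) where
  "A \<cdot> B = B O A"

text \<open>Identities between unbounded operators hold in general only after restriction to the domain
  common to both sides, or after closure: for instance \<open>(A \<ominus> B) \<oplus> (B \<ominus> C)\<close> is not defined
  outside the domain of \<open>B\<close>, whereas \<open>A \<ominus> C\<close> may be.\<close>

definition op_restrict :: "oper \<Rightarrow> vec set \<Rightarrow> oper" where
  "op_restrict A D = {(\<psi>, \<eta>) \<in> A. \<psi> \<in> D}"

definition op_closure :: "oper \<Rightarrow> oper" where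
  "op_closure A = {(\<psi>, \<eta>). \<psi> \<in> ell2 \<and> \<eta> \<in> ell2 \<and>
     (\<exists>u v. (\<forall>k::nat. (u k, v k) \<in> A) \<and>
        (\<lambda>k. nrm (\<lambda>n. u k n - \<psi> n)) \<longlonglongrightarrow> 0 \<and>
        (\<lambda>k. nrm (\<lambda>n. v k n - \<eta> n)) \<longlonglongrightarrow> 0)}"


section \<open>Spectral calculus\<close>

definition projection :: "(vec \<Rightarrow> vec) \<Rightarrow> bool" where
  "projection P \<longleftrightarrow>
     (\<forall>\<psi>\<in>ell2. P \<psi> \<in> ell2) \<and>
     (\<forall>\<psi>\<in>ell2. \<forall>\<phi>\<in>ell2. \<forall>c. P (\<lambda>n. \<psi> n + c * \<phi> n) = (\<lambda>n. P \<psi> n + c * P \<phi> n)) \<and>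
     (\<forall>\<psi>\<in>ell2. P (P \<psi>) = P \<psi>) \<and>
     (\<forall>\<psi>\<in>ell2. \<forall>\<phi>\<in>ell2. cip \<phi> (P \<psi>) = cip (P \<phi>) \<psi>)"

definition projection_valued_measure :: "(real set \<Rightarrow> vec \<Rightarrow> vec) \<Rightarrow> bool" where
  "projection_valued_measure E \<longleftrightarrow>
     (\<forall>B\<in>sets borel. projection (E B)) \<and>
     (\<forall>\<psi>\<in>ell2. E {} \<psi> = (\<lambda>n. 0) \<and> E UNIV \<psi> = \<psi>) \<and>
     (\<forall>B\<in>sets borel. \<forall>C\<in>sets borel. \<forall>\<psi>\<in>ell2. E (B \<inter> C) \<psi> = E B (E C \<psi>)) \<and>
     (\<forall>B::nat \<Rightarrow> real set. range B \<subseteq> sets borel \<longrightarrow> disjoint_family B \<longrightarrow>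
        (\<forall>\<psi>\<in>ell2. (\<lambda>N. nrm (\<lambda>n. (\<Sum>i<N. E (B i) \<psi> n) - E (\<Union>i. B i) \<psi> n)) \<longlonglongrightarrow> 0))"

definition scalar_measure :: "(real set \<Rightarrow> vec \<Rightarrow> vec) \<Rightarrow> vec \<Rightarrow> real measure" where
  "scalar_measure E \<psi> = measure_of UNIV (sets borel) (\<lambda>B. ennreal (Re (cip \<psi> (E B \<psi>))))"

definition spectral_dom :: "(real set \<Rightarrow> vec \<Rightarrow> vec) \<Rightarrow> (real \<Rightarrow> real) \<Rightarrow> vec set" where
  "spectral_dom E f =
     {\<psi>\<in>ell2. (\<integral>\<^sup>+ x. ennreal ((f x)\<^sup>2) \<partial>scalar_measure E \<psi>) < \<infinity>}"

text \<open>The integral of \<open>f\<close> against the complex measure \<open>B \<mapsto> cip \<phi> (E B \<psi>)\<close>, obtained from the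
  positive measures \<open>scalar_measure E\<close> by polarization (\<open>cip\<close> is antilinear in its first argument).\<close>

definition spectral_form ::
    "(real set \<Rightarrow> vec \<Rightarrow> vec) \<Rightarrow> (real \<Rightarrow> real) \<Rightarrow> vec \<Rightarrow> vec \<Rightarrow> complex" where
  "spectral_form E f \<phi> \<psi> =
     (\<Sum>k<4. (- \<i>) ^ k *
        complex_of_real (\<integral>x. f x \<partial>scalar_measure E (\<lambda>n. \<phi> n + \<i> ^ k * \<psi> n))) / 4"

text \<open>The operator \<open>\<integral> f dE\<close>, with its maximal domain \<open>spectral_dom E f\<close>.\<close>

definition spectral_integral :: "(real set \<Rightarrow> vec \<Rightarrow> vec) \<Rightarrow> (real \<Rightarrow> real) \<Rightarrow> oper" where
  "spectral_integral E f =
     {(\<psi>, \<eta>). \<psi> \<in> spectral_dom E f \<and> \<eta> \<in> ell2 \<and>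
        (\<forall>\<phi>\<in>spectral_dom E f. cip \<phi> \<eta> = spectral_form E f \<phi> \<psi>)}"

text \<open>By the spectral theorem, a self-adjoint operator has exactly one spectral measure, up to
  the irrelevant values of \<open>E\<close> at non-Borel sets and at vectors outside \<open>ell2\<close>.\<close>

definition spectral_measure :: "oper \<Rightarrow> real set \<Rightarrow> vec \<Rightarrow> vec" where
  "spectral_measure A =
     (SOME E. projection_valued_measure E \<and> spectral_integral E (\<lambda>x. x) = A)"

definition borel_calculus :: "(real \<Rightarrow> real) \<Rightarrow> oper \<Rightarrow> oper" where
  "borel_calculus f A = spectral_integral (spectral_measure A) f"


section \<open>The frequency operators\<close>

definition S_op :: "real \<Rightarrow> real \<Rightarrow> oper" where
  "S_op S0 \<Delta>S = {(\<psi>, \<eta>). \<psi> \<in> ell2 \<and> \<eta> \<in> ell2 \<and>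
     (\<forall>n. \<eta> n = complex_of_real (S0 + of_int n * \<Delta>S) * \<psi> n)}"

definition T_op :: "int \<Rightarrow> oper" where
  "T_op a = {(\<psi>, \<lambda>n. \<psi> (n - a)) | \<psi>. \<psi> \<in> ell2}"

definition freq_op :: "real \<Rightarrow> real \<Rightarrow> (real \<Rightarrow> real) \<Rightarrow> int \<Rightarrow> oper" where
  "freq_op S0 \<Delta>S f \<alpha> =
     borel_calculus f (S_op S0 \<Delta>S) \<ominus>
     T_op (- \<alpha>) \<cdot> borel_calculus f (S_op S0 \<Delta>S) \<cdot> T_op \<alpha>"

lemma ket_in_ell2: "ket n \<in> ell2"
proof -
  have "(\<lambda>m. (cmod (ket n m))\<^sup>2) summable_on {n}"
    by (rule summable_on_finite) simp
  then show ?thesis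
    unfolding ell2_def mem_Collect_eq
    by (rule summable_on_cong_neutral[THEN iffD1, rotated -1]) (auto simp: ket_def)
qed

lemma T_op_ket: "(ket n, ket (n + a)) \<in> T_op a"
proof -
  have "ket (n + a) = (\<lambda>m. ket n (m - a))"
    by (auto simp: ket_def fun_eq_iff)
  then show ?thesis
    using ket_in_ell2 unfolding T_op_def by blast
qed

end

(*
  Only the spectral measure E with E B |n> = |n> if S0 + n \<Delta>S lies in B, and 0 otherwise,
  integrates to S: each |n> is an eigenvector of S, which forces its scalar measure to be
  concentrated at the eigenvalue. So f(S) is multiplication by g n = f (S0 + n \<Delta>S) on its
  maximal domain, conjugation with a shift translates g, and both sides of the identity multiply
  by g n - g (n + \<alpha> + \<beta>). The domain of the right-hand side may be smaller, because g (n + \<alpha>)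
  times the vector must be square-summable too; but it contains all finitely supported vectors,
  and truncation approximates every point of the graph of the left-hand side.
*)

theory Submission
  imports Defs
begin

section \<open>Square-summable sequences\<close>

text \<open>\<open>spectral_measure\<close> is an arbitrary choice, so nothing can be computed from
  it directly. Two facts make it usable: \<open>diag_proj\<close> is a spectral measure of the
  multiplication operator, so the choice is not vacuous; and every other candidate agrees with it on
  Borel sets and \<open>ell2\<close>, so the choice does not matter. The obstacle is the second
  fact. The condition on E speaks only of \<open>spectral_form\<close>, which polarization spreads
  over the scalar measures of four vectors \<open>\<phi> n + \<i> ^ k * \<psi> n\<close>. Taking
  \<open>E B \<psi>\<close> for \<phi> keeps these measures within reach: each has a density with
  respect to the scalar measure of \<psi> that is constant on B and constant off B. The form then
  collapses to an integral over B, which for an eigenvector determines the measure. Symmetry of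
  \<open>E B\<close> carries the result from the basis vectors to every coordinate of every
  vector.\<close>

lemma ell2_mono:
  assumes "\<phi> \<in> ell2" "\<And>n. cmod (\<psi> n) \<le> cmod (\<phi> n)"
  shows "\<psi> \<in> ell2"
  using assms unfolding ell2_def mem_Collect_eq
  by (elim summable_on_comparison_test) (auto intro: power_mono)

lemma ell2_add:
  assumes "\<phi> \<in> ell2" "\<psi> \<in> ell2"
  shows "(\<lambda>n. \<phi> n + \<psi> n) \<in> ell2"
proof -
  have "(cmod (\<phi> n + \<psi> n))\<^sup>2 \<le> 2 * (cmod (\<phi> n))\<^sup>2 + 2 * (cmod (\<psi> n))\<^sup>2" for n
  proof -
    have "(cmod (\<phi> n + \<psi> n))\<^sup>2 \<le> (cmod (\<phi> n) + cmod (\<psi> n))\<^sup>2"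
      by (intro power_mono norm_triangle_ineq) auto
    also have "\<dots> \<le> 2 * (cmod (\<phi> n))\<^sup>2 + 2 * (cmod (\<psi> n))\<^sup>2"
      using sum_squares_bound[of "cmod (\<phi> n)" "cmod (\<psi> n)"] by (simp add: power2_sum)
    finally show ?thesis .
  qed
  moreover have "(\<lambda>n. 2 * (cmod (\<phi> n))\<^sup>2 + 2 * (cmod (\<psi> n))\<^sup>2) summable_on UNIV"
    using assms unfolding ell2_def by (intro summable_on_add summable_on_cmult_right) auto
  ultimately show ?thesis
    unfolding ell2_def mem_Collect_eq
    by (intro summable_on_comparison_test[where g = "\<lambda>n. (cmod (\<phi> n + \<psi> n))\<^sup>2"]) auto
qed

lemma ell2_scale:
  assumes "\<psi> \<in> ell2"
  shows "(\<lambda>n. c * \<psi> n) \<in> ell2"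
  using assms unfolding ell2_def
  by (auto simp: norm_mult power_mult_distrib intro: summable_on_cmult_right)

lemma ell2_diff:
  assumes "\<phi> \<in> ell2" "\<psi> \<in> ell2"
  shows "(\<lambda>n. \<phi> n - \<psi> n) \<in> ell2"
  using ell2_add[OF assms(1) ell2_scale[OF assms(2), of "-1"]] by simp

lemma ell2_zero: "(\<lambda>n. 0) \<in> ell2"
  by (simp add: ell2_def)

lemma ell2_sum:
  assumes "\<And>i. i \<in> I \<Longrightarrow> g i \<in> ell2"
  shows "(\<lambda>n. \<Sum>i\<in>I. g i n) \<in> ell2"
  using assms by (induction I rule: infinite_finite_induct) (auto intro: ell2_add ell2_zero)

lemma ell2_shift:
  assumes "\<psi> \<in> ell2"
  shows "(\<lambda>n. \<psi> (n + a)) \<in> ell2"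
  using summable_on_reindex_bij_betw[OF bij_plus_right[of a], of "\<lambda>n. (cmod (\<psi> n))\<^sup>2"] assms
  by (simp add: ell2_def)

lemma ell2_finite_support:
  assumes "finite {n. \<psi> n \<noteq> 0}"
  shows "\<psi> \<in> ell2"
  using assms unfolding ell2_def mem_Collect_eq
  by (intro finite_nonzero_values_imp_summable_on) simp

section \<open>Inner product and norm on \<open>ell2\<close>\<close>

lemma ell2_abs_summable_product:
  assumes "\<phi> \<in> ell2" "\<psi> \<in> ell2"
  shows "(\<lambda>n. norm (cnj (\<phi> n) * \<psi> n)) summable_on UNIV"
  by (rule abs_summable_product)
    (use assms in \<open>simp_all add: ell2_def norm_mult power2_eq_square\<close>)

lemma cip_has_sum:
  assumes "\<phi> \<in> ell2" "\<psi> \<in> ell2"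
  shows "((\<lambda>n. cnj (\<phi> n) * \<psi> n) has_sum cip \<phi> \<psi>) UNIV"
  unfolding cip_def
  by (rule has_sum_infsum[OF abs_summable_summable[OF ell2_abs_summable_product[OF assms]]])

lemma cip_add_right:
  assumes "\<phi> \<in> ell2" "\<psi> \<in> ell2" "\<xi> \<in> ell2"
  shows "cip \<phi> (\<lambda>n. \<psi> n + c * \<xi> n) = cip \<phi> \<psi> + c * cip \<phi> \<xi>"
proof -
  have "((\<lambda>n. cnj (\<phi> n) * \<psi> n + c * (cnj (\<phi> n) * \<xi> n)) has_sum (cip \<phi> \<psi> + c * cip \<phi> \<xi>)) UNIV"
    by (intro has_sum_add has_sum_cmult_right cip_has_sum assms)
  then show ?thesis
    unfolding cip_def[of \<phi> "\<lambda>n. \<psi> n + c * \<xi> n"] by (intro infsumI) (simp add: algebra_simps)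
qed

lemma cip_cnj: "cip \<psi> \<phi> = cnj (cip \<phi> \<psi>)"
  unfolding cip_def by (subst infsum_cnj[symmetric]) (simp add: mult.commute)

lemma cip_add_left:
  assumes "\<phi> \<in> ell2" "\<psi> \<in> ell2" "\<xi> \<in> ell2"
  shows "cip (\<lambda>n. \<psi> n + c * \<xi> n) \<phi> = cip \<psi> \<phi> + cnj c * cip \<xi> \<phi>"
  by (subst (1 2 3) cip_cnj) (simp add: cip_add_right assms)

lemma cip_scale_right: "cip \<phi> (\<lambda>n. c * \<psi> n) = c * cip \<phi> \<psi>"
  unfolding cip_def by (simp add: infsum_cmult_right'[symmetric] mult.left_commute)

lemma nrm_nonneg: "0 \<le> nrm \<psi>"
  by (simp add: nrm_def infsum_nonneg)

lemma nrm_sq: "(nrm \<psi>)\<^sup>2 = (\<Sum>\<^sub>\<infinity>n. (cmod (\<psi> n))\<^sup>2)"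
  by (simp add: nrm_def infsum_nonneg)

lemma cip_self:
  assumes "\<psi> \<in> ell2"
  shows "cip \<psi> \<psi> = complex_of_real ((nrm \<psi>)\<^sup>2)"
proof -
  have "((\<lambda>n. (cmod (\<psi> n))\<^sup>2) has_sum (nrm \<psi>)\<^sup>2) UNIV"
    using assms unfolding nrm_sq ell2_def by (intro has_sum_infsum) auto
  then have "((\<lambda>n. complex_of_real ((cmod (\<psi> n))\<^sup>2)) has_sum complex_of_real ((nrm \<psi>)\<^sup>2)) UNIV"
    by (rule has_sum_of_real)
  then show ?thesis
    unfolding cip_def
    by (intro infsumI) (simp add: complex_mult_cnj complex_norm_square mult.commute
        del: of_real_power)
qed

lemma L2_set_le_nrm:
  assumes "\<psi> \<in> ell2" "finite F"
  shows "L2_set (\<lambda>n. cmod (\<psi> n)) F \<le> nrm \<psi>"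
  using assms unfolding nrm_def L2_set_def ell2_def
  by (intro real_sqrt_le_mono finite_sum_le_infsum) auto

text \<open>Converse to \<open>L2_set_le_nrm\<close>: together they transfer the Minkowski
  inequality for finite sums to \<open>nrm\<close>.\<close>

lemma nrm_leI:
  assumes "\<psi> \<in> ell2" "0 \<le> b" "\<And>F. finite F \<Longrightarrow> L2_set (\<lambda>n. cmod (\<psi> n)) F \<le> b"
  shows "nrm \<psi> \<le> b"
proof -
  have "(\<Sum>\<^sub>\<infinity>n. (cmod (\<psi> n))\<^sup>2) \<le> b\<^sup>2"
  proof (rule infsum_le_finite_sums)
    show "(\<lambda>n. (cmod (\<psi> n))\<^sup>2) summable_on UNIV"
      using assms by (simp add: ell2_def)
    fix F :: "int set"
    assume "finite F"
    from assms(3)[OF this] show "(\<Sum>n\<in>F. (cmod (\<psi> n))\<^sup>2) \<le> b\<^sup>2"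
      unfolding L2_set_def by (rule sqrt_le_D)
  qed
  then show ?thesis
    unfolding nrm_def using assms(2) real_le_lsqrt by (auto simp: infsum_nonneg)
qed

lemma nrm_triangle:
  assumes "\<phi> \<in> ell2" "\<psi> \<in> ell2"
  shows "nrm (\<lambda>n. \<phi> n + \<psi> n) \<le> nrm \<phi> + nrm \<psi>"
proof (rule nrm_leI)
  fix F :: "int set"
  assume F: "finite F"
  have "L2_set (\<lambda>n. cmod (\<phi> n + \<psi> n)) F \<le> L2_set (\<lambda>n. cmod (\<phi> n) + cmod (\<psi> n)) F"
    by (intro L2_set_mono norm_triangle_ineq) auto
  also have "\<dots> \<le> L2_set (\<lambda>n. cmod (\<phi> n)) F + L2_set (\<lambda>n. cmod (\<psi> n)) F"
    by (rule L2_set_triangle_ineq)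
  also have "\<dots> \<le> nrm \<phi> + nrm \<psi>"
    by (intro add_mono L2_set_le_nrm assms F)
  finally show "L2_set (\<lambda>n. cmod (\<phi> n + \<psi> n)) F \<le> nrm \<phi> + nrm \<psi>" .
qed (use assms in \<open>auto intro: ell2_add nrm_nonneg add_nonneg_nonneg\<close>)

lemma cauchy_schwarz:
  assumes "\<phi> \<in> ell2" "\<psi> \<in> ell2"
  shows "cmod (cip \<phi> \<psi>) \<le> nrm \<phi> * nrm \<psi>"
proof -
  have "cmod (cip \<phi> \<psi>) \<le> (\<Sum>\<^sub>\<infinity>n. norm (cnj (\<phi> n) * \<psi> n))"
    unfolding cip_def by (intro norm_infsum_bound ell2_abs_summable_product assms)
  also have "\<dots> \<le> nrm \<phi> * nrm \<psi>"
  proof (rule infsum_le_finite_sums[OF ell2_abs_summable_product[OF assms]])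
    fix F :: "int set"
    assume F: "finite F"
    have "(\<Sum>n\<in>F. norm (cnj (\<phi> n) * \<psi> n)) \<le> L2_set (\<lambda>n. cmod (\<phi> n)) F * L2_set (\<lambda>n. cmod (\<psi> n)) F"
      using L2_set_mult_ineq[of "\<lambda>n. cmod (\<phi> n)" "\<lambda>n. cmod (\<psi> n)" F] by (simp add: norm_mult)
    also have "\<dots> \<le> nrm \<phi> * nrm \<psi>"
      by (intro mult_mono L2_set_le_nrm assms F nrm_nonneg L2_set_nonneg)
    finally show "(\<Sum>n\<in>F. norm (cnj (\<phi> n) * \<psi> n)) \<le> nrm \<phi> * nrm \<psi>" .
  qed
  finally show ?thesis .
qed

lemma nrm_eq_0D:
  assumes "\<psi> \<in> ell2" "nrm \<psi> = 0"
  shows "\<psi> = (\<lambda>n. 0)"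
proof
  fix n
  show "\<psi> n = 0"
    using L2_set_le_nrm[OF assms(1), of "{n}"] assms(2) by (simp add: L2_set_def)
qed

lemma cip_ket_left: "cip (ket n) \<psi> = \<psi> n"
proof -
  have "cip (ket n) \<psi> = (\<Sum>\<^sub>\<infinity>m\<in>{n}. cnj (ket n m) * \<psi> m)"
    unfolding cip_def by (rule infsum_cong_neutral) (auto simp: ket_def)
  then show ?thesis by (simp add: ket_def)
qed

text \<open>A finite set F carries all but an arbitrarily small part of the mass of \<psi>, and each
  of its indices leaves the decreasing sets for good at some stage. This serves both the countable
  additivity of \<open>diag_proj\<close> and the truncation argument for closures.\<close>

lemma nrm_off_decreasing_tendsto_0:
  fixes A :: "nat \<Rightarrow> int set"
  assumes \<psi>: "\<psi> \<in> ell2" and A: "decseq A" "(\<Inter>N. A N) = {}"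
  shows "(\<lambda>N. nrm (\<lambda>n. if n \<in> A N then \<psi> n else 0)) \<longlonglongrightarrow> 0"
proof (rule LIMSEQ_I)
  fix r :: real
  assume r: "0 < r"
  define g where "g n = (cmod (\<psi> n))\<^sup>2" for n
  have g: "g summable_on UNIV" "\<And>n. 0 \<le> g n"
    using \<psi> by (simp_all add: ell2_def g_def[abs_def])
  \<comment> \<open>Half of the target, since the finite approximation only yields a non-strict
    bound.\<close>
  have "0 < r\<^sup>2 / 2" using r by simp
  from infsum_finite_approximation[OF g(1) this] obtain F
    where F: "finite F" "dist (sum g F) (infsum g UNIV) \<le> r\<^sup>2 / 2" by blast
  have "\<exists>N. \<forall>M\<ge>N. n \<notin> A M" for n
  proof -
    obtain N where "n \<notin> A N" using A(2) by blast
    then show ?thesis using A(1) unfolding decseq_def by blast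
  qed
  then obtain N where N: "\<And>n M. N n \<le> M \<Longrightarrow> n \<notin> A M" by metis
  have "nrm (\<lambda>n. if n \<in> A M then \<psi> n else 0) < r" if M: "Max (insert 0 (N ` F)) \<le> M" for M
  proof -
    have disj: "F \<inter> A M = {}"
      using M F(1) N by (auto simp: Max_le_iff)
    have "(nrm (\<lambda>n. if n \<in> A M then \<psi> n else 0))\<^sup>2 = infsum g (A M)"
      unfolding nrm_sq by (rule infsum_cong_neutral) (auto simp: g_def)
    also have "\<dots> \<le> infsum g (- F)"
      using disj by (intro infsum_mono2 summable_on_subset_banach[OF g(1)]) (auto simp: g(2))
    also have "\<dots> = infsum g UNIV - sum g F"
    proof -
      have "infsum g (F \<union> - F) = infsum g F + infsum g (- F)"
        using F(1) by (intro infsum_Un_disjoint summable_on_subset_banach[OF g(1)]) auto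
      then show ?thesis using F(1) by simp
    qed
    also have "\<dots> < r\<^sup>2"
      using F(2) r by (simp add: dist_real_def abs_le_iff)
        (smt (verit) r zero_less_power field_sum_of_halves)
    finally show ?thesis
      using r power_less_imp_less_base by fastforce
  qed
  then show "\<exists>no. \<forall>n\<ge>no. norm (nrm (\<lambda>na. if na \<in> A n then \<psi> na else 0) - 0) < r"
    using nrm_nonneg by auto
qed

section \<open>Diagonal spectral measures\<close>

definition diag_proj :: "(int \<Rightarrow> real) \<Rightarrow> real set \<Rightarrow> vec \<Rightarrow> vec" where
  "diag_proj l B \<psi> = (\<lambda>n. if l n \<in> B then \<psi> n else 0)"

definition mult_op :: "(int \<Rightarrow> real) \<Rightarrow> oper" where
  "mult_op g = {(\<psi>, \<eta>). \<psi> \<in> ell2 \<and> \<eta> \<in> ell2 \<and> (\<forall>n. \<eta> n = complex_of_real (g n) * \<psi> n)}"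

text \<open>The sum of point masses \<open>(cmod (\<psi> n))\<^sup>2\<close> at the points
  \<open>l n\<close>. As an image of a weighted counting measure it turns integrals over the reals
  into sums over the integers.\<close>

definition weight_measure :: "(int \<Rightarrow> real) \<Rightarrow> vec \<Rightarrow> real measure" where
  "weight_measure l \<psi> =
     distr (density (count_space UNIV) (\<lambda>n. ennreal ((cmod (\<psi> n))\<^sup>2))) borel l"

lemma diag_proj_ell2: "\<psi> \<in> ell2 \<Longrightarrow> diag_proj l B \<psi> \<in> ell2"
  by (erule ell2_mono) (simp add: diag_proj_def)

section \<open>Sums over a set as integrals against counting measure\<close>

lemma summable_on_iff_integrable_count_space:
  fixes g :: "'a \<Rightarrow> real"
  shows "g summable_on A \<longleftrightarrow> integrable (count_space A) g"
  by (subst summable_on_iff_abs_summable_on_real)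
    (simp only: abs_summable_equivalent Infinite_Set_Sum.abs_summable_on_def)

lemma integral_count_space_eq_infsum:
  fixes g :: "'a \<Rightarrow> real"
  assumes "g summable_on A"
  shows "integral\<^sup>L (count_space A) g = infsum g A"
  using assms infsetsum_infsum[of g A]
  unfolding summable_on_iff_integrable_count_space Infinite_Set_Sum.abs_summable_on_def
    infsetsum_def
  by blast

lemma nn_integral_count_space_eq_infsum:
  fixes g :: "'a \<Rightarrow> real"
  assumes "g summable_on A" "\<And>x. 0 \<le> g x"
  shows "(\<integral>\<^sup>+ x. ennreal (g x) \<partial>count_space A) = ennreal (infsum g A)"
  using assms
  by (subst nn_integral_eq_integral)
    (auto simp: summable_on_iff_integrable_count_space[symmetric] integral_count_space_eq_infsum)

lemma Re_cip_diag_proj: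
  assumes "\<psi> \<in> ell2"
  shows "((\<lambda>n. (cmod (\<psi> n))\<^sup>2 * indicator (l -` B) n) has_sum Re (cip \<psi> (diag_proj l B \<psi>))) UNIV"
proof -
  have "((\<lambda>n. Re (cnj (\<psi> n) * diag_proj l B \<psi> n)) has_sum Re (cip \<psi> (diag_proj l B \<psi>))) UNIV"
    by (intro has_sum_Re cip_has_sum diag_proj_ell2 assms)
  moreover have "Re (cnj (\<psi> n) * diag_proj l B \<psi> n) = (cmod (\<psi> n))\<^sup>2 * indicator (l -` B) n" for n
    by (simp add: diag_proj_def cmod_power2 flip: power2_eq_square)
  ultimately show ?thesis by simp
qed

lemma emeasure_weight_measure:
  assumes "\<psi> \<in> ell2" "B \<in> sets borel"
  shows "emeasure (weight_measure l \<psi>) B = ennreal (Re (cip \<psi> (diag_proj l B \<psi>)))"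
proof -
  have "emeasure (weight_measure l \<psi>) B
      = (\<integral>\<^sup>+ n. ennreal ((cmod (\<psi> n))\<^sup>2) * indicator (l -` B) n \<partial>count_space UNIV)"
    using assms(2) unfolding weight_measure_def
    by (subst emeasure_distr) (auto simp: emeasure_density)
  also have "\<dots> = (\<integral>\<^sup>+ n. ennreal ((cmod (\<psi> n))\<^sup>2 * indicator (l -` B) n) \<partial>count_space UNIV)"
    by (intro nn_integral_cong) (simp add: indicator_def)
  also have "\<dots> = ennreal (Re (cip \<psi> (diag_proj l B \<psi>)))"
    using Re_cip_diag_proj[OF assms(1), of l B]
    by (subst nn_integral_count_space_eq_infsum) (auto simp: has_sum_iff)
  finally show ?thesis .
qed

text \<open>\<open>measure_of\<close> depends only on the values on the sigma-algebra, and applied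
  to the values of a genuine measure it returns that measure. So exhibiting M settles at once that
  the set function is a measure and which one.\<close>

lemma scalar_measure_eqI:
  assumes "sets M = sets borel"
    and "\<And>B. B \<in> sets borel \<Longrightarrow> emeasure M B = ennreal (Re (cip \<psi> (E B \<psi>)))"
  shows "scalar_measure E \<psi> = M"
proof -
  have "scalar_measure E \<psi> = measure_of UNIV (sets borel) (emeasure M)"
    unfolding scalar_measure_def
  proof (rule measure_of_eq)
    fix a :: "real set"
    assume "a \<in> sigma_sets UNIV (sets borel)"
    then have "a \<in> sets borel"
      using sets.sigma_sets_eq[of "borel :: real measure"] by simp
    then show "ennreal (Re (cip \<psi> (E a \<psi>))) = emeasure M a" using assms(2) by simp
  qed simp
  also have "\<dots> = M"
    using measure_of_of_measure[of M] assms(1) sets_eq_imp_space_eq[OF assms(1)] by simp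
  finally show ?thesis .
qed

text \<open>Agreement is asked only on Borel sets and \<open>ell2\<close>, which is all that
  uniqueness can give. The locale is instantiated both with \<open>diag_proj l\<close> and with the
  chosen spectral measure.\<close>

locale diagonal_spectral_measure =
  fixes E :: "real set \<Rightarrow> vec \<Rightarrow> vec" and l :: "int \<Rightarrow> real"
  assumes diagonal: "B \<in> sets borel \<Longrightarrow> \<psi> \<in> ell2 \<Longrightarrow> E B \<psi> = diag_proj l B \<psi>"
begin

lemma scalar_measure_eq_weight_measure:
  assumes "\<psi> \<in> ell2"
  shows "scalar_measure E \<psi> = weight_measure l \<psi>"
  by (rule scalar_measure_eqI)
    (use assms in \<open>simp_all add: emeasure_weight_measure diagonal, simp add: weight_measure_def\<close>)

lemma spectral_dom_eq:
  assumes f: "f \<in> borel_measurable borel"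
  shows "spectral_dom E f = {\<psi>\<in>ell2. (\<lambda>n. complex_of_real (f (l n)) * \<psi> n) \<in> ell2}"
proof -
  have "(\<integral>\<^sup>+ x. ennreal ((f x)\<^sup>2) \<partial>scalar_measure E \<psi>) < \<infinity>
      \<longleftrightarrow> (\<lambda>n. complex_of_real (f (l n)) * \<psi> n) \<in> ell2" if \<psi>: "\<psi> \<in> ell2" for \<psi>
  proof -
    have "(\<integral>\<^sup>+ x. ennreal ((f x)\<^sup>2) \<partial>scalar_measure E \<psi>)
        = (\<integral>\<^sup>+ n. ennreal ((cmod (complex_of_real (f (l n)) * \<psi> n))\<^sup>2) \<partial>count_space UNIV)"
      unfolding scalar_measure_eq_weight_measure[OF \<psi>] weight_measure_def using f
      by (simp add: nn_integral_distr nn_integral_density norm_mult power_mult_distrib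
          ennreal_mult mult.commute)
    then show ?thesis
      unfolding ell2_def mem_Collect_eq summable_on_iff_integrable_count_space
      by (simp add: integrable_iff_bounded)
  qed
  then show ?thesis unfolding spectral_dom_def by blast
qed

lemma spectral_dom_add:
  assumes f: "f \<in> borel_measurable borel" and "\<phi> \<in> spectral_dom E f" "\<psi> \<in> spectral_dom E f"
  shows "(\<lambda>n. \<phi> n + c * \<psi> n) \<in> spectral_dom E f"
proof -
  let ?F = "\<lambda>\<psi> n. complex_of_real (f (l n)) * \<psi> n"
  have "(\<lambda>n. ?F \<phi> n + c * ?F \<psi> n) \<in> ell2"
    using assms by (intro ell2_add ell2_scale) (auto simp: spectral_dom_eq)
  then show ?thesis
    using assms by (auto simp: spectral_dom_eq algebra_simps intro!: ell2_add ell2_scale)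
qed

lemma integral_scalar_measure:
  assumes f: "f \<in> borel_measurable borel" and \<psi>: "\<psi> \<in> spectral_dom E f"
  shows "complex_of_real (\<integral>x. f x \<partial>scalar_measure E \<psi>)
     = cip \<psi> (\<lambda>n. complex_of_real (f (l n)) * \<psi> n)"
proof -
  have \<psi>': "\<psi> \<in> ell2" "(\<lambda>n. complex_of_real (f (l n)) * \<psi> n) \<in> ell2"
    using \<psi> by (auto simp: spectral_dom_eq[OF f])
  have eq: "cnj (\<psi> n) * (complex_of_real (f (l n)) * \<psi> n)
      = complex_of_real ((cmod (\<psi> n))\<^sup>2 * f (l n))" for n
    using complex_norm_square[of "\<psi> n"] by (simp add: mult_ac)
  have s: "((\<lambda>n. (cmod (\<psi> n))\<^sup>2 * f (l n)) has_sum
      Re (cip \<psi> (\<lambda>n. complex_of_real (f (l n)) * \<psi> n))) UNIV"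
    using has_sum_Re[OF cip_has_sum[OF \<psi>']] by (simp only: eq Re_complex_of_real)
  have "(\<integral>x. f x \<partial>scalar_measure E \<psi>) = (\<integral>n. (cmod (\<psi> n))\<^sup>2 * f (l n) \<partial>count_space UNIV)"
    unfolding scalar_measure_eq_weight_measure[OF \<psi>'(1)] weight_measure_def using f
    by (simp add: integral_distr integral_density)
  also have "\<dots> = Re (cip \<psi> (\<lambda>n. complex_of_real (f (l n)) * \<psi> n))"
    using s by (simp add: integral_count_space_eq_infsum has_sum_iff)
  finally have "(\<integral>x. f x \<partial>scalar_measure E \<psi>) = \<dots>" .
  \<comment> \<open>By \<open>eq\<close> all terms of the sum are real, so its real part is its
    whole value.\<close>
  moreover have "cip \<psi> (\<lambda>n. complex_of_real (f (l n)) * \<psi> n)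
      = complex_of_real (Re (cip \<psi> (\<lambda>n. complex_of_real (f (l n)) * \<psi> n)))"
    using has_sum_of_real[OF s, where 'a = complex] cip_has_sum[OF \<psi>']
    by (simp only: eq) (rule has_sum_unique)
  ultimately show ?thesis by simp
qed

lemma spectral_form_eq:
  assumes f: "f \<in> borel_measurable borel"
    and \<phi>: "\<phi> \<in> spectral_dom E f" and \<psi>: "\<psi> \<in> spectral_dom E f"
  shows "spectral_form E f \<phi> \<psi> = cip \<phi> (\<lambda>n. complex_of_real (f (l n)) * \<psi> n)"
proof -
  let ?F = "\<lambda>\<psi> n. complex_of_real (f (l n)) * \<psi> n"
  have ell2: "\<phi> \<in> ell2" "?F \<phi> \<in> ell2" "\<psi> \<in> ell2" "?F \<psi> \<in> ell2"
    using \<phi> \<psi> by (auto simp: spectral_dom_eq[OF f])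
  have "complex_of_real (\<integral>x. f x \<partial>scalar_measure E (\<lambda>n. \<phi> n + c * \<psi> n))
      = cip \<phi> (?F \<phi>) + c * cip \<phi> (?F \<psi>) + cnj c * (cip \<psi> (?F \<phi>) + c * cip \<psi> (?F \<psi>))" for c
  proof -
    have F: "?F (\<lambda>n. \<phi> n + c * \<psi> n) = (\<lambda>n. ?F \<phi> n + c * ?F \<psi> n)"
      by (simp add: algebra_simps)
    have "complex_of_real (\<integral>x. f x \<partial>scalar_measure E (\<lambda>n. \<phi> n + c * \<psi> n))
        = cip (\<lambda>n. \<phi> n + c * \<psi> n) (\<lambda>n. ?F \<phi> n + c * ?F \<psi> n)"
      using integral_scalar_measure[OF f spectral_dom_add[OF f \<phi> \<psi>, of c]] unfolding F .
    also have "\<dots> = cip \<phi> (\<lambda>n. ?F \<phi> n + c * ?F \<psi> n) + cnj c * cip \<psi> (\<lambda>n. ?F \<phi> n + c * ?F \<psi> n)"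
      by (intro cip_add_left ell2_add ell2_scale ell2)
    also have "\<dots> = cip \<phi> (?F \<phi>) + c * cip \<phi> (?F \<psi>) + cnj c * (cip \<psi> (?F \<phi>) + c * cip \<psi> (?F \<psi>))"
      by (simp only: cip_add_right ell2)
    finally show ?thesis .
  qed
  note * = this
  \<comment> \<open>With \<open>c = \<i> ^ k\<close> the weight \<open>(- \<i>) ^ k\<close> is
    \<open>cnj c\<close>. Over the four values of c the sums of \<open>cnj c\<close> and of its
    square vanish, and \<open>c * cnj c = 1\<close>; hence only the term linear in c survives, four
    times.\<close>
  show ?thesis
    unfolding spectral_form_def *
    by (simp add: numeral_eq_Suc lessThan_Suc algebra_simps)
qed

text \<open>The basis vectors lie in the domain whatever f is, so testing against them recovers
  every coordinate of \<eta>. Conversely, \<eta> being in \<open>ell2\<close> is exactly the domain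
  condition on \<psi>.\<close>

lemma spectral_integral_eq_mult_op:
  assumes f: "f \<in> borel_measurable borel"
  shows "spectral_integral E f = mult_op (\<lambda>n. f (l n))"
proof (rule set_eqI, clarify)
  fix \<psi> \<eta>
  let ?F = "\<lambda>\<psi> n. complex_of_real (f (l n)) * \<psi> n"
  have ket: "ket n \<in> spectral_dom E f" for n
  proof -
    have "finite {m. ?F (ket n) m \<noteq> 0}"
      by (rule finite_subset[of _ "{n}"]) (auto simp: ket_def)
    then show ?thesis
      by (simp add: spectral_dom_eq[OF f] ket_in_ell2 ell2_finite_support)
  qed
  show "(\<psi>, \<eta>) \<in> spectral_integral E f \<longleftrightarrow> (\<psi>, \<eta>) \<in> mult_op (\<lambda>n. f (l n))"
  proof
    assume *: "(\<psi>, \<eta>) \<in> spectral_integral E f"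
    have "\<eta> n = ?F \<psi> n" for n
    proof -
      have "cip (ket n) \<eta> = cip (ket n) (?F \<psi>)"
        using * ket spectral_form_eq[OF f ket] by (auto simp: spectral_integral_def)
      then show ?thesis by (simp add: cip_ket_left)
    qed
    then show "(\<psi>, \<eta>) \<in> mult_op (\<lambda>n. f (l n))"
      using * by (auto simp: spectral_integral_def mult_op_def spectral_dom_def)
  next
    assume "(\<psi>, \<eta>) \<in> mult_op (\<lambda>n. f (l n))"
    then have *: "\<psi> \<in> ell2" "\<eta> \<in> ell2" "\<eta> = ?F \<psi>" by (auto simp: mult_op_def)
    then have "\<psi> \<in> spectral_dom E f" by (auto simp: spectral_dom_eq[OF f])
    then show "(\<psi>, \<eta>) \<in> spectral_integral E f"
      using * by (auto simp: spectral_integral_def spectral_form_eq[OF f])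
  qed
qed

end

lemma projection_diag_proj: "projection (diag_proj l B)"
  unfolding projection_def
proof (intro conjI ballI allI)
  fix \<psi> \<phi>
  show "cip \<phi> (diag_proj l B \<psi>) = cip (diag_proj l B \<phi>) \<psi>"
    unfolding cip_def by (rule infsum_cong) (simp add: diag_proj_def)
qed (simp add: diag_proj_ell2, auto simp: diag_proj_def)

lemma projection_valued_measure_diag_proj: "projection_valued_measure (diag_proj l)"
  unfolding projection_valued_measure_def
proof (intro conjI ballI allI impI)
  fix B :: "nat \<Rightarrow> real set" and \<psi>
  assume B: "disjoint_family B" and \<psi>: "\<psi> \<in> ell2"
  \<comment> \<open>The indices whose eigenvalue lies in a set not yet summed: the N-th partial sum
    misses its limit by precisely the part of \<psi> on \<open>A N\<close>.\<close>
  define A where "A N = {n. l n \<in> (\<Union>i\<in>{N..}. B i)}" for N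
  have "(\<lambda>N. nrm (\<lambda>n. if n \<in> A N then \<psi> n else 0)) \<longlonglongrightarrow> 0"
  proof (rule nrm_off_decreasing_tendsto_0[OF \<psi>])
    show "decseq A"
      unfolding decseq_def A_def by fastforce
    have "n \<notin> (\<Inter>N. A N)" for n
    proof
      assume n: "n \<in> (\<Inter>N. A N)"
      then obtain i where "l n \<in> B i" by (auto simp: A_def)
      \<comment> \<open>Starting at \<open>Suc i\<close> leaves out \<open>B i\<close> itself, so
        the set found next is a different member of the disjoint family.\<close>
      moreover from n have "n \<in> A (Suc i)" by blast
      then obtain j where "j \<ge> Suc i" "l n \<in> B j" by (auto simp: A_def)
      moreover from this have "B i \<inter> B j = {}"
        using B by (intro disjoint_family_onD) auto
      ultimately show False by blast
    qed
    then show "(\<Inter>N. A N) = {}" by blast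
  qed
  moreover have "(\<Sum>i<N. diag_proj l (B i) \<psi> n) - diag_proj l (\<Union>i. B i) \<psi> n
      = - (if n \<in> A N then \<psi> n else 0)" for n N
  proof (cases "\<exists>i. l n \<in> B i")
    case True
    then obtain i where i: "l n \<in> B i" ..
    have uniq: "l n \<in> B j \<longleftrightarrow> j = i" for j
      using B i by (auto simp: disjoint_family_on_def)
    then show ?thesis by (auto simp: diag_proj_def A_def not_less)
  qed (auto simp: diag_proj_def A_def)
  ultimately show "(\<lambda>N. nrm (\<lambda>n. (\<Sum>i<N. diag_proj l (B i) \<psi> n) - diag_proj l (\<Union>i. B i) \<psi> n))
      \<longlonglongrightarrow> 0"
    by (simp add: nrm_def)
qed (auto simp: projection_diag_proj diag_proj_def)

section \<open>Uniqueness of the spectral measure of a multiplication operator\<close>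

lemma cip_sum_right:
  assumes "\<phi> \<in> ell2" "\<And>i. i \<in> I \<Longrightarrow> g i \<in> ell2"
  shows "cip \<phi> (\<lambda>n. \<Sum>i\<in>I. g i n) = (\<Sum>i\<in>I. cip \<phi> (g i))"
  using assms(2)
proof (induction I rule: infinite_finite_induct)
  case (insert i I)
  then show ?case
    using cip_add_right[OF assms(1), of "g i" "\<lambda>n. \<Sum>i\<in>I. g i n" 1] by (simp add: ell2_sum)
qed (simp_all add: cip_def)

locale pvm =
  fixes E :: "real set \<Rightarrow> vec \<Rightarrow> vec"
  assumes pvm: "projection_valued_measure E"
begin

lemma proj_ell2: "B \<in> sets borel \<Longrightarrow> \<psi> \<in> ell2 \<Longrightarrow> E B \<psi> \<in> ell2"
  using pvm by (simp add: projection_valued_measure_def projection_def)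

lemma proj_linear:
  "B \<in> sets borel \<Longrightarrow> \<psi> \<in> ell2 \<Longrightarrow> \<phi> \<in> ell2 \<Longrightarrow>
    E B (\<lambda>n. \<psi> n + c * \<phi> n) = (\<lambda>n. E B \<psi> n + c * E B \<phi> n)"
  using pvm by (simp add: projection_valued_measure_def projection_def)

lemma proj_symmetric:
  "B \<in> sets borel \<Longrightarrow> \<phi> \<in> ell2 \<Longrightarrow> \<psi> \<in> ell2 \<Longrightarrow> cip (E B \<phi>) \<psi> = cip \<phi> (E B \<psi>)"
  using pvm by (simp add: projection_valued_measure_def projection_def)

lemma proj_Int:
  "B \<in> sets borel \<Longrightarrow> C \<in> sets borel \<Longrightarrow> \<psi> \<in> ell2 \<Longrightarrow> E B (E C \<psi>) = E (B \<inter> C) \<psi>"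
  using pvm by (simp add: projection_valued_measure_def)

lemma proj_empty: "\<psi> \<in> ell2 \<Longrightarrow> E {} \<psi> = (\<lambda>n. 0)"
  using pvm by (simp add: projection_valued_measure_def)

lemma proj_UNIV: "\<psi> \<in> ell2 \<Longrightarrow> E UNIV \<psi> = \<psi>"
  using pvm by (simp add: projection_valued_measure_def)

text \<open>Idempotence (\<open>proj_Int\<close> with equal sets) supplies a second factor, which
  symmetry moves to the left. This makes the scalar set function nonnegative.\<close>

lemma cip_proj:
  assumes "B \<in> sets borel" "\<psi> \<in> ell2"
  shows "cip \<psi> (E B \<psi>) = complex_of_real ((nrm (E B \<psi>))\<^sup>2)"
proof -
  have "cip \<psi> (E B \<psi>) = cip \<psi> (E B (E B \<psi>))"
    using assms by (simp add: proj_Int)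
  also have "\<dots> = cip (E B \<psi>) (E B \<psi>)"
    using assms by (simp add: proj_symmetric proj_ell2)
  finally show ?thesis using assms by (simp add: cip_self proj_ell2)
qed

text \<open>Pairing with \<psi> turns additivity in norm into additivity of numbers, the error being
  controlled by Cauchy-Schwarz.\<close>

lemma proj_sums:
  fixes A :: "nat \<Rightarrow> real set"
  assumes A: "range A \<subseteq> sets borel" "disjoint_family A" and \<psi>: "\<psi> \<in> ell2"
  shows "(\<lambda>i. (nrm (E (A i) \<psi>))\<^sup>2) sums (nrm (E (\<Union>i. A i) \<psi>))\<^sup>2"
proof -
  let ?d = "\<lambda>N n. (\<Sum>i<N. E (A i) \<psi> n) - E (\<Union>i. A i) \<psi> n"
  have meas: "A i \<in> sets borel" "(\<Union>i. A i) \<in> sets borel" for i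
    using A(1) by auto
  have sum_ell2: "(\<lambda>n. \<Sum>i<N. E (A i) \<psi> n) \<in> ell2" for N
    by (intro ell2_sum proj_ell2 meas \<psi>)
  have d: "?d N \<in> ell2" for N
    by (intro ell2_diff sum_ell2 proj_ell2 meas \<psi>)
  have cip_d: "cip \<psi> (?d N)
      = complex_of_real ((\<Sum>i<N. (nrm (E (A i) \<psi>))\<^sup>2) - (nrm (E (\<Union>i. A i) \<psi>))\<^sup>2)" for N
  proof -
    have "cip \<psi> (?d N) = cip \<psi> (\<lambda>n. \<Sum>i<N. E (A i) \<psi> n) - cip \<psi> (E (\<Union>i. A i) \<psi>)"
      using cip_add_right[OF \<psi> sum_ell2 proj_ell2[OF meas(2) \<psi>], of N "-1"] by simp
    then show ?thesis
      by (simp add: cip_sum_right proj_ell2 meas \<psi> cip_proj)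
  qed
  have "(\<lambda>N. nrm (?d N)) \<longlonglongrightarrow> 0"
    using pvm A \<psi> unfolding projection_valued_measure_def by blast
  then have lim: "(\<lambda>N. nrm \<psi> * nrm (?d N)) \<longlonglongrightarrow> 0"
    by (rule tendsto_mult_right_zero)
  have "(\<lambda>N. (\<Sum>i<N. (nrm (E (A i) \<psi>))\<^sup>2) - (nrm (E (\<Union>i. A i) \<psi>))\<^sup>2) \<longlonglongrightarrow> 0"
  proof (rule Lim_null_comparison[OF _ lim])
    show "\<forall>\<^sub>F N in sequentially.
        norm ((\<Sum>i<N. (nrm (E (A i) \<psi>))\<^sup>2) - (nrm (E (\<Union>i. A i) \<psi>))\<^sup>2) \<le> nrm \<psi> * nrm (?d N)"
      using cauchy_schwarz[OF \<psi> d] unfolding cip_d norm_of_real by simp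
  qed
  then show ?thesis
    unfolding sums_def using LIM_zero_iff by fastforce
qed

section \<open>Scalar measures of an arbitrary projection-valued measure\<close>

lemma sets_scalar_measure: "sets (scalar_measure E \<psi>) = sets borel"
  unfolding scalar_measure_def
  using sets.sigma_sets_eq[of "borel :: real measure"] by simp

lemma space_scalar_measure: "space (scalar_measure E \<psi>) = UNIV"
  using sets_eq_imp_space_eq[OF sets_scalar_measure] by simp

text \<open>\<open>measure_of\<close> silently yields the zero measure when the given set function
  is not a measure, so positivity and countable additivity must be established before its values can
  be read off.\<close>

lemma emeasure_scalar_measure:
  assumes \<psi>: "\<psi> \<in> ell2" and B: "B \<in> sets borel"
  shows "emeasure (scalar_measure E \<psi>) B = ennreal ((nrm (E B \<psi>))\<^sup>2)"
proof -
  have alg: "sigma_algebra UNIV (sets (borel :: real measure))"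
    using sets.sigma_algebra_axioms[of "borel :: real measure"] by simp
  have "emeasure (scalar_measure E \<psi>) B = ennreal (Re (cip \<psi> (E B \<psi>)))"
    unfolding scalar_measure_def
  proof (rule emeasure_measure_of_sigma[OF alg _ _ B])
    show "positive (sets borel) (\<lambda>B. ennreal (Re (cip \<psi> (E B \<psi>))))"
      using \<psi> by (simp add: positive_def proj_empty cip_def)
    show "countably_additive (sets borel) (\<lambda>B. ennreal (Re (cip \<psi> (E B \<psi>))))"
    proof (rule countably_additiveI)
      fix A :: "nat \<Rightarrow> real set"
      assume A: "range A \<subseteq> sets borel" "disjoint_family A" "(\<Union>i. A i) \<in> sets borel"
      have "A i \<in> sets borel" for i using A(1) by auto
      then have *: "Re (cip \<psi> (E (A i) \<psi>)) = (nrm (E (A i) \<psi>))\<^sup>2" for i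
        by (simp add: cip_proj \<psi> del: of_real_power)
      have **: "Re (cip \<psi> (E (\<Union>i. A i) \<psi>)) = (nrm (E (\<Union>i. A i) \<psi>))\<^sup>2"
        by (simp only: cip_proj[OF A(3) \<psi>] Re_complex_of_real)
      show "(\<Sum>i. ennreal (Re (cip \<psi> (E (A i) \<psi>)))) = ennreal (Re (cip \<psi> (E (\<Union>i. A i) \<psi>)))"
        unfolding * ** by (intro suminf_ennreal_eq proj_sums A(1,2) \<psi>) simp
    qed
  qed
  then show ?thesis using assms by (simp add: cip_proj del: of_real_power)
qed

lemma finite_measure_scalar_measure:
  assumes "\<psi> \<in> ell2"
  shows "finite_measure (scalar_measure E \<psi>)"
proof (rule finite_measureI)
  have "emeasure (scalar_measure E \<psi>) UNIV = ennreal ((nrm (E UNIV \<psi>))\<^sup>2)"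
    by (rule emeasure_scalar_measure) (use assms in auto)
  then show "emeasure (scalar_measure E \<psi>) (space (scalar_measure E \<psi>)) \<noteq> \<infinity>"
    by (simp add: space_scalar_measure del: ennreal_power)
qed

lemma measure_scalar_measure:
  assumes "\<psi> \<in> ell2" "B \<in> sets borel"
  shows "measure (scalar_measure E \<psi>) B = (nrm (E B \<psi>))\<^sup>2"
  using assms by (simp add: measure_def emeasure_scalar_measure)

text \<open>On the range of \<open>E B\<close> the vector is \<open>1 + c\<close> times the
  component of \<psi>, on the complement it is c times that component. These are the vectors that
  polarization of the form at \<open>E B \<psi>\<close> and \<psi> produces; \<open>c = 0\<close>
  gives the scalar measure of \<open>E B \<psi>\<close> itself.\<close>

lemma scalar_measure_proj_add:
  assumes \<psi>: "\<psi> \<in> ell2" and B: "B \<in> sets borel"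
  shows "scalar_measure E (\<lambda>n. E B \<psi> n + c * \<psi> n)
    = density (scalar_measure E \<psi>) (\<lambda>x. ennreal (if x \<in> B then (cmod (1 + c))\<^sup>2 else (cmod c)\<^sup>2))"
    (is "_ = density ?M ?h")
proof (rule scalar_measure_eqI)
  fix C :: "real set"
  assume C: "C \<in> sets borel"
  interpret M: finite_measure ?M by (rule finite_measure_scalar_measure[OF \<psi>])
  let ?\<mu> = "measure ?M"
  have BC: "B \<inter> C \<in> sets borel" "C - B \<in> sets borel" using B C by auto
  note e = proj_ell2[OF B \<psi>] proj_ell2[OF C \<psi>] proj_ell2[OF BC(1) \<psi>]
  have \<mu>: "cip \<psi> (E D \<psi>) = complex_of_real (?\<mu> D)" if "D \<in> sets borel" for D
    using that \<psi> by (simp add: cip_proj measure_scalar_measure)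
  have split: "?\<mu> C = ?\<mu> (B \<inter> C) + ?\<mu> (C - B)"
  proof -
    have "?\<mu> ((B \<inter> C) \<union> (C - B)) = ?\<mu> (B \<inter> C) + ?\<mu> (C - B)"
      using BC by (intro M.finite_measure_Union) (auto simp: sets_scalar_measure)
    moreover have "(B \<inter> C) \<union> (C - B) = C" by blast
    ultimately show ?thesis by simp
  qed
  have "E C (\<lambda>n. E B \<psi> n + c * \<psi> n) = (\<lambda>n. E (B \<inter> C) \<psi> n + c * E C \<psi> n)"
    by (simp add: proj_linear[OF C e(1) \<psi>] proj_Int[OF C B \<psi>] Int_commute)
  then have "cip (\<lambda>n. E B \<psi> n + c * \<psi> n) (E C (\<lambda>n. E B \<psi> n + c * \<psi> n))
      = cip (\<lambda>n. E B \<psi> n + c * \<psi> n) (\<lambda>n. E (B \<inter> C) \<psi> n + c * E C \<psi> n)"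
    by simp
  also have "\<dots> = cip (E B \<psi>) (\<lambda>n. E (B \<inter> C) \<psi> n + c * E C \<psi> n)
      + cnj c * cip \<psi> (\<lambda>n. E (B \<inter> C) \<psi> n + c * E C \<psi> n)"
    by (intro cip_add_left ell2_add ell2_scale e \<psi>)
  also have "\<dots> = cip (E B \<psi>) (E (B \<inter> C) \<psi>) + c * cip (E B \<psi>) (E C \<psi>)
      + cnj c * (cip \<psi> (E (B \<inter> C) \<psi>) + c * cip \<psi> (E C \<psi>))"
    by (simp only: cip_add_right e \<psi>)
  also have "\<dots> = complex_of_real (?\<mu> (B \<inter> C)) + c * complex_of_real (?\<mu> (B \<inter> C))
      + cnj c * (complex_of_real (?\<mu> (B \<inter> C)) + c * complex_of_real (?\<mu> C))"
    using B C BC by (simp add: proj_symmetric proj_ell2 proj_Int \<psi> \<mu> flip: Int_assoc)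
  \<comment> \<open>After \<open>split\<close>, the coefficient of the mass of
    \<open>B \<inter> C\<close> is \<open>1 + c + cnj c + c * cnj c\<close>, and that of
    \<open>C - B\<close> is \<open>c * cnj c\<close>.\<close>
  also have "\<dots> = complex_of_real ((cmod (1 + c))\<^sup>2 * ?\<mu> (B \<inter> C) + (cmod c)\<^sup>2 * ?\<mu> (C - B))"
    unfolding split by (simp add: complex_norm_square algebra_simps del: of_real_power)
  finally have "ennreal (Re (cip (\<lambda>n. E B \<psi> n + c * \<psi> n) (E C (\<lambda>n. E B \<psi> n + c * \<psi> n))))
      = ennreal ((cmod (1 + c))\<^sup>2 * ?\<mu> (B \<inter> C) + (cmod c)\<^sup>2 * ?\<mu> (C - B))"
    by simp
  also have "\<dots> = ennreal ((cmod (1 + c))\<^sup>2) * emeasure ?M (B \<inter> C)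
      + ennreal ((cmod c)\<^sup>2) * emeasure ?M (C - B)"
    by (simp add: M.emeasure_eq_measure ennreal_mult ennreal_plus)
  also have "\<dots> = (\<integral>\<^sup>+ x. ennreal ((cmod (1 + c))\<^sup>2) * indicator (B \<inter> C) x
      + ennreal ((cmod c)\<^sup>2) * indicator (C - B) x \<partial>?M)"
  proof -
    note [simp] = sets_scalar_measure
    have m: "B \<inter> C \<in> sets ?M" "C - B \<in> sets ?M" using BC by simp_all
    note [measurable] = m
    show ?thesis using m by (subst nn_integral_add) (simp_all add: nn_integral_cmult_indicator)
  qed
  also have "\<dots> = (\<integral>\<^sup>+ x. ?h x * indicator C x \<partial>?M)"
    by (intro nn_integral_cong) (auto simp: indicator_def)
  also have "\<dots> = emeasure (density ?M ?h) C"
    using B C by (subst emeasure_density)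
      (auto simp: sets_scalar_measure cong: measurable_cong_sets)
  finally show "emeasure (density ?M ?h) C
      = ennreal (Re (cip (\<lambda>n. E B \<psi> n + c * \<psi> n) (E C (\<lambda>n. E B \<psi> n + c * \<psi> n))))" ..
qed (simp add: sets_scalar_measure)

lemma measurable_scalar_measure:
  "f \<in> borel_measurable borel \<Longrightarrow> f \<in> borel_measurable (scalar_measure E \<psi>)"
  by (simp cong: measurable_cong_sets add: sets_scalar_measure)

text \<open>Makes \<open>E B \<psi>\<close> an admissible test vector in
  \<open>spectral_integral\<close>: its scalar measure is that of \<psi> cut down to B, so the
  integral of \<open>(f x)\<^sup>2\<close> can only shrink.\<close>

lemma proj_spectral_dom:
  assumes f: "f \<in> borel_measurable borel"
    and \<psi>: "\<psi> \<in> spectral_dom E f" and B: "B \<in> sets borel"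
  shows "E B \<psi> \<in> spectral_dom E f"
proof -
  have \<psi>': "\<psi> \<in> ell2" "(\<integral>\<^sup>+ x. ennreal ((f x)\<^sup>2) \<partial>scalar_measure E \<psi>) < \<infinity>"
    using \<psi> by (auto simp: spectral_dom_def)
  have h: "(\<lambda>x. ennreal (if x \<in> B then 1 else 0)) \<in> borel_measurable borel"
    using B by measurable
  have "scalar_measure E (E B \<psi>)
      = density (scalar_measure E \<psi>) (\<lambda>x. ennreal (if x \<in> B then 1 else 0))"
    using scalar_measure_proj_add[OF \<psi>'(1) B, of 0] by (simp cong: if_cong)
  then have "(\<integral>\<^sup>+ x. ennreal ((f x)\<^sup>2) \<partial>scalar_measure E (E B \<psi>))
      = (\<integral>\<^sup>+ x. ennreal (if x \<in> B then 1 else 0) * ennreal ((f x)\<^sup>2) \<partial>scalar_measure E \<psi>)"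
    using f h by (simp add: nn_integral_density measurable_scalar_measure)
  also have "\<dots> \<le> (\<integral>\<^sup>+ x. ennreal ((f x)\<^sup>2) \<partial>scalar_measure E \<psi>)"
    by (intro nn_integral_mono) auto
  finally show ?thesis
    using \<psi>' proj_ell2[OF B \<psi>'(1)] by (auto simp: spectral_dom_def)
qed

text \<open>On a finite measure space, square-integrable functions are integrable. This ensures that
  the integrals in the form are genuine and not the default value 0.\<close>

lemma spectral_dom_integrable:
  assumes f: "f \<in> borel_measurable borel" and \<psi>: "\<psi> \<in> spectral_dom E f"
  shows "integrable (scalar_measure E \<psi>) f"
proof -
  have \<psi>': "\<psi> \<in> ell2" "(\<integral>\<^sup>+ x. ennreal ((f x)\<^sup>2) \<partial>scalar_measure E \<psi>) < \<infinity>"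
    using \<psi> by (auto simp: spectral_dom_def)
  interpret M: finite_measure "scalar_measure E \<psi>"
    by (rule finite_measure_scalar_measure[OF \<psi>'(1)])
  have "integrable (scalar_measure E \<psi>) (\<lambda>x. 1 + (f x)\<^sup>2)"
    using f \<psi>'(2) by (intro Bochner_Integration.integrable_add M.integrable_const)
      (auto simp: integrable_iff_bounded measurable_scalar_measure)
  then show ?thesis
  proof (rule Bochner_Integration.integrable_bound)
    have "\<bar>y\<bar> \<le> 1 + y\<^sup>2" for y :: real
      using sum_squares_bound[of "\<bar>y\<bar>" 1] by simp
    then show "AE x in scalar_measure E \<psi>. norm (f x) \<le> norm (1 + (f x)\<^sup>2)"
      by simp
  qed (use f in \<open>simp add: measurable_scalar_measure\<close>)
qed

lemma spectral_form_proj: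
  assumes f: "f \<in> borel_measurable borel"
    and \<psi>: "\<psi> \<in> spectral_dom E f" and B: "B \<in> sets borel"
  shows "spectral_form E f (E B \<psi>) \<psi>
    = complex_of_real (set_lebesgue_integral (scalar_measure E \<psi>) B f)"
proof -
  let ?M = "scalar_measure E \<psi>"
  have ell2: "\<psi> \<in> ell2" using \<psi> by (simp add: spectral_dom_def)
  note int = spectral_dom_integrable[OF f \<psi>]
  have intB: "integrable ?M (\<lambda>x. indicator B x * f x)"
    using integrable_mult_indicator[OF _ int, of B] B by (simp add: sets_scalar_measure)
  have *: "(\<integral>x. f x \<partial>scalar_measure E (\<lambda>n. E B \<psi> n + c * \<psi> n))
      = (\<integral>x. f x \<partial>?M) + (1 + 2 * Re c) * (\<integral>x. indicator B x * f x \<partial>?M)" if c: "cmod c = 1" for c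
  proof -
    \<comment> \<open>Written as 1 plus an excess: the density is 1 off B, so the full integral of f
      splits off and the excess multiplies the integral over B.\<close>
    have c': "(cmod (1 + c))\<^sup>2 = 1 + (1 + 2 * Re c)"
      using c cmod_power2[of c] by (simp add: cmod_power2 power2_sum)
    have h: "(\<lambda>x. if x \<in> B then (cmod (1 + c))\<^sup>2 else (cmod c)\<^sup>2) \<in> borel_measurable borel"
      using B by measurable
    have "(\<integral>x. f x \<partial>scalar_measure E (\<lambda>n. E B \<psi> n + c * \<psi> n))
        = (\<integral>x. (if x \<in> B then (cmod (1 + c))\<^sup>2 else (cmod c)\<^sup>2) * f x \<partial>?M)"
      unfolding scalar_measure_proj_add[OF ell2 B]
      using f h by (subst integral_density) (auto simp: measurable_scalar_measure)
    also have "\<dots> = (\<integral>x. f x + (1 + 2 * Re c) * (indicator B x * f x) \<partial>?M)"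
      by (intro Bochner_Integration.integral_cong) (auto simp: c' c algebra_simps)
    finally show ?thesis using int intB by simp
  qed
  have **: "cmod (\<i> ^ k) = 1" for k by (simp add: norm_power)
  \<comment> \<open>The powers of \<open>- \<i>\<close> sum to zero, which removes everything
    independent of k. The values of \<open>2 * Re (\<i> ^ k)\<close> are 2, 0, -2, 0; weighted they
    add up to 4, cancelling the denominator.\<close>
  show ?thesis
    unfolding spectral_form_def set_lebesgue_integral_def *[OF **]
    by (simp add: numeral_eq_Suc lessThan_Suc algebra_simps)
qed

text \<open>Pythagoras: the squared norm of \<open>\<psi> - E B \<psi>\<close> is the difference of
  the squared norms of \<psi> and \<open>E B \<psi>\<close>.\<close>

lemma proj_eq_self:
  assumes \<psi>: "\<psi> \<in> ell2" and B: "B \<in> sets borel" and eq: "nrm (E B \<psi>) = nrm \<psi>"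
  shows "E B \<psi> = \<psi>"
proof -
  let ?d = "\<lambda>n. \<psi> n + (-1) * E B \<psi> n"
  note e = \<psi> proj_ell2[OF B \<psi>]
  have d: "?d \<in> ell2" by (intro ell2_add ell2_scale e)
  have "cip ?d ?d = cip \<psi> ?d + cnj (-1) * cip (E B \<psi>) ?d"
    by (intro cip_add_left d e)
  also have "\<dots> = cip \<psi> \<psi> + (-1) * cip \<psi> (E B \<psi>)
      + cnj (-1) * (cip (E B \<psi>) \<psi> + (-1) * cip (E B \<psi>) (E B \<psi>))"
    by (simp only: cip_add_right e)
  also have "\<dots> = 0"
    using eq \<psi> B by (simp add: cip_self proj_symmetric cip_proj e)
  finally have "complex_of_real ((nrm ?d)\<^sup>2) = 0" unfolding cip_self[OF d] .
  then have "nrm ?d = 0" by (simp only: of_real_eq_0_iff power_eq_0_iff)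
  from nrm_eq_0D[OF d this] show ?thesis by (auto simp: fun_eq_iff dest: fun_cong)
qed

text \<open>Testing the eigenvalue equation against \<open>E B \<psi>\<close> gives
  \<open>\<kappa> \<mu>(B) = \<integral>\<^sub>B x d\<mu>(x)\<close> for every Borel set \<open>B\<close>, where \<open>\<mu>\<close> is the scalar measure
  of \<open>\<psi>\<close>; hence \<open>\<mu>\<close> is concentrated at \<open>\<kappa>\<close>.\<close>

lemma proj_eigenvector:
  assumes eig: "(\<psi>, \<lambda>n. complex_of_real \<kappa> * \<psi> n) \<in> spectral_integral E (\<lambda>x. x)"
    and B: "B \<in> sets borel"
  shows "E B \<psi> = (if \<kappa> \<in> B then \<psi> else (\<lambda>n. 0))"
proof -
  let ?M = "scalar_measure E \<psi>"
  have dom: "\<psi> \<in> spectral_dom E (\<lambda>x. x)"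
    using eig by (simp add: spectral_integral_def)
  then have \<psi>: "\<psi> \<in> ell2" by (simp add: spectral_dom_def)
  interpret M: finite_measure ?M by (rule finite_measure_scalar_measure[OF \<psi>])
  have id: "(\<lambda>x::real. x) \<in> borel_measurable borel" by simp
  have "AE x in ?M. x = \<kappa>"
  proof (rule density_unique_real)
    fix C assume "C \<in> sets ?M"
    then have C: "C \<in> sets borel" by (simp add: sets_scalar_measure)
    have "complex_of_real (set_lebesgue_integral ?M C (\<lambda>x. x))
        = cip (E C \<psi>) (\<lambda>n. complex_of_real \<kappa> * \<psi> n)"
      using eig proj_spectral_dom[OF id dom C] spectral_form_proj[OF id dom C]
      by (simp add: spectral_integral_def)
    also have "\<dots> = complex_of_real (\<kappa> * measure ?M C)"
      using C \<psi> by (simp add: cip_scale_right proj_symmetric cip_proj measure_scalar_measure)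
    finally have "set_lebesgue_integral ?M C (\<lambda>x. x) = \<kappa> * measure ?M C"
      by (simp only: of_real_eq_iff)
    also have "\<dots> = set_lebesgue_integral ?M C (\<lambda>x. \<kappa>)"
      using C by (simp add: set_lebesgue_integral_def sets_scalar_measure mult.commute)
    finally show "set_lebesgue_integral ?M C (\<lambda>x. x) = set_lebesgue_integral ?M C (\<lambda>x. \<kappa>)" .
  qed (use spectral_dom_integrable[OF id dom] in auto)
  \<comment> \<open>Membership in a set is thus almost everywhere constant, so each set has either
    full or zero measure; in terms of norms, \<open>E B\<close> either fixes \<psi> or kills
    it.\<close>
  then have ae: "AE x in ?M. x \<in> C \<longleftrightarrow> \<kappa> \<in> C" for C
    by eventually_elim simp
  show ?thesis
  proof (cases "\<kappa> \<in> B")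
    case True
    have "measure ?M B = measure ?M UNIV"
      using ae[of B] True B by (intro measure_eq_AE) (auto simp: sets_scalar_measure)
    then have "nrm (E B \<psi>) = nrm \<psi>"
      using B \<psi> by (simp add: measure_scalar_measure proj_UNIV nrm_nonneg)
    then show ?thesis using True proj_eq_self[OF \<psi> B] by simp
  next
    case False
    have "measure ?M B = measure ?M {}"
      using ae[of B] False B by (intro measure_eq_AE) (auto simp: sets_scalar_measure)
    then have "nrm (E B \<psi>) = 0"
      using B \<psi> by (simp add: measure_scalar_measure)
    then show ?thesis using False nrm_eq_0D[OF proj_ell2[OF B \<psi>]] by simp
  qed
qed

text \<open>Coordinate n of \<open>E B \<psi>\<close> is its inner product with
  \<open>ket n\<close>; symmetry moves \<open>E B\<close> onto \<open>ket n\<close>, an eigenvector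
  on which its action is known.\<close>

lemma diagonal_spectral_measureI:
  assumes "spectral_integral E (\<lambda>x. x) = mult_op l"
  shows "diagonal_spectral_measure E l"
proof
  fix B :: "real set" and \<psi>
  assume B: "B \<in> sets borel" and \<psi>: "\<psi> \<in> ell2"
  have "E B \<psi> n = diag_proj l B \<psi> n" for n
  proof -
    have "(ket n, \<lambda>m. complex_of_real (l n) * ket n m) \<in> spectral_integral E (\<lambda>x. x)"
      unfolding assms using ket_in_ell2 by (auto simp: mult_op_def ket_def intro!: ell2_scale)
    from proj_eigenvector[OF this B]
    have "cip (E B (ket n)) \<psi> = (if l n \<in> B then \<psi> n else 0)"
      using cip_ket_left by (simp add: cip_def)
    moreover have "cip (E B (ket n)) \<psi> = E B \<psi> n"
      using B \<psi> by (simp add: proj_symmetric ket_in_ell2 cip_ket_left)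
    ultimately show ?thesis by (simp add: diag_proj_def)
  qed
  then show "E B \<psi> = diag_proj l B \<psi>" ..
qed

end

lemma borel_calculus_mult_op:
  assumes f: "f \<in> borel_measurable borel"
  shows "borel_calculus f (mult_op l) = mult_op (\<lambda>n. f (l n))"
proof -
  interpret D: diagonal_spectral_measure "diag_proj l" l
    by unfold_locales (rule refl)
  have "projection_valued_measure (diag_proj l) \<and> spectral_integral (diag_proj l) (\<lambda>x. x) = mult_op l"
    using projection_valued_measure_diag_proj D.spectral_integral_eq_mult_op[of "\<lambda>x. x"] by simp
  then have E: "projection_valued_measure (spectral_measure (mult_op l)) \<and>
      spectral_integral (spectral_measure (mult_op l)) (\<lambda>x. x) = mult_op l"
    unfolding spectral_measure_def
    by (rule someI[where P = "\<lambda>E. projection_valued_measure E \<and> spectral_integral E (\<lambda>x. x) = mult_op l"])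
  interpret pvm "spectral_measure (mult_op l)"
    using E by unfold_locales simp
  interpret S: diagonal_spectral_measure "spectral_measure (mult_op l)" l
    using E by (intro diagonal_spectral_measureI) simp
  show ?thesis
    unfolding borel_calculus_def by (rule S.spectral_integral_eq_mult_op[OF f])
qed

section \<open>Frequency operators\<close>

lemma ell2_shift_iff: "(\<lambda>n. \<psi> (n + a)) \<in> ell2 \<longleftrightarrow> \<psi> \<in> ell2"
  using ell2_shift[of \<psi> a] ell2_shift[of "\<lambda>n. \<psi> (n + a)" "- a"] by auto

lemma op_diff_ell2:
  assumes "A \<subseteq> ell2 \<times> ell2" "B \<subseteq> ell2 \<times> ell2"
  shows "A \<ominus> B \<subseteq> ell2 \<times> ell2"
  using assms ell2_diff unfolding op_diff_def by blast

text \<open>Both products must be square-summable separately. Since \<open>g - h\<close> may be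
  bounded while g and h are not, the graph can be strictly smaller than
  \<open>mult_op (\<lambda>n. g n - h n)\<close>; this is the source of the domain issues in the
  theorem.\<close>

lemma mult_op_diff_iff:
  "(\<psi>, \<eta>) \<in> mult_op g \<ominus> mult_op h \<longleftrightarrow>
     \<psi> \<in> ell2 \<and> (\<lambda>n. complex_of_real (g n) * \<psi> n) \<in> ell2 \<and>
     (\<lambda>n. complex_of_real (h n) * \<psi> n) \<in> ell2 \<and>
     \<eta> = (\<lambda>n. complex_of_real (g n - h n) * \<psi> n)"
  (is "?L \<longleftrightarrow> ?R")
proof
  assume ?L
  then obtain \<eta>1 \<eta>2 where "(\<psi>, \<eta>1) \<in> mult_op g" "(\<psi>, \<eta>2) \<in> mult_op h" "\<eta> = (\<lambda>n. \<eta>1 n - \<eta>2 n)"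
    by (auto simp: op_diff_def)
  moreover from this have "\<eta>1 = (\<lambda>n. complex_of_real (g n) * \<psi> n)"
    "\<eta>2 = (\<lambda>n. complex_of_real (h n) * \<psi> n)" by (auto simp: mult_op_def)
  ultimately show ?R by (auto simp: mult_op_def algebra_simps)
next
  assume R: ?R
  then have "(\<psi>, \<lambda>n. complex_of_real (g n) * \<psi> n) \<in> mult_op g"
    "(\<psi>, \<lambda>n. complex_of_real (h n) * \<psi> n) \<in> mult_op h" by (auto simp: mult_op_def)
  moreover have "\<eta> = (\<lambda>n. complex_of_real (g n) * \<psi> n - complex_of_real (h n) * \<psi> n)"
    using R by (auto simp: algebra_simps)
  ultimately show ?L
    unfolding op_diff_def mem_Collect_eq by (intro exI conjI) simp_all
qed

text \<open>The range condition ensures that the output of A lies in the domain of the outer shift;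
  applying \<open>T_op a\<close> to both entries of a pair then undoes the conjugation.\<close>

lemma shift_conjugate_iff:
  assumes "Range A \<subseteq> ell2"
  shows "(\<psi>, \<eta>) \<in> T_op (- a) \<cdot> A \<cdot> T_op a \<longleftrightarrow>
     \<psi> \<in> ell2 \<and> ((\<lambda>n. \<psi> (n - a)), (\<lambda>n. \<eta> (n - a))) \<in> A"
  (is "?L \<longleftrightarrow> ?R")
proof
  assume ?L
  then show ?R by (auto simp: op_mult_def T_op_def)
next
  assume R: ?R
  then have "(\<lambda>n. \<eta> (n - a)) \<in> ell2" using assms by blast
  then have "((\<lambda>n. \<eta> (n - a)), \<eta>) \<in> T_op (- a)"
    by (auto simp: T_op_def intro!: exI[of _ "\<lambda>n. \<eta> (n - a)"])
  moreover have "(\<psi>, \<lambda>n. \<psi> (n - a)) \<in> T_op a"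
    using R by (auto simp: T_op_def)
  ultimately show ?L using R unfolding op_mult_def by blast
qed

lemma shift_conjugate_mult_op:
  "T_op (- a) \<cdot> mult_op g \<cdot> T_op a = mult_op (\<lambda>n. g (n + a))"
proof (rule set_eqI, clarify)
  fix \<psi> \<eta>
  have r: "Range (mult_op g) \<subseteq> ell2" by (auto simp: mult_op_def)
  have "(\<lambda>n. \<phi> (n - a)) \<in> ell2 \<longleftrightarrow> \<phi> \<in> ell2" for \<phi>
    using ell2_shift_iff[of \<phi> "- a"] by simp
  moreover have "(\<forall>n. \<eta> (n - a) = complex_of_real (g n) * \<psi> (n - a)) \<longleftrightarrow>
      (\<forall>n. \<eta> n = complex_of_real (g (n + a)) * \<psi> n)"
    by (metis add_diff_cancel_right' diff_add_cancel)
  ultimately show "(\<psi>, \<eta>) \<in> T_op (- a) \<cdot> mult_op g \<cdot> T_op a \<longleftrightarrow> (\<psi>, \<eta>) \<in> mult_op (\<lambda>n. g (n + a))"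
    unfolding shift_conjugate_iff[OF r] by (auto simp: mult_op_def)
qed

section \<open>Closures and truncation\<close>

lemma op_closure_mono: "A \<subseteq> B \<Longrightarrow> op_closure A \<subseteq> op_closure B"
  unfolding op_closure_def by blast

text \<open>Multiplication operators commute with cutting off a sequence outside a finite set, so
  restricting one to any domain containing the finitely supported sequences does not change
  its closure.\<close>

lemma op_closure_subset_truncation:
  assumes A: "A \<subseteq> ell2 \<times> ell2"
    and trunc: "\<And>\<psi> \<eta> N. (\<psi>, \<eta>) \<in> A \<Longrightarrow>
      ((\<lambda>n. if \<bar>n\<bar> < int N then \<psi> n else 0), (\<lambda>n. if \<bar>n\<bar> < int N then \<eta> n else 0)) \<in> B"
  shows "op_closure A \<subseteq> op_closure B"
proof clarify
  fix \<psi> \<eta>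
  assume "(\<psi>, \<eta>) \<in> op_closure A"
  then obtain u v where \<psi>: "\<psi> \<in> ell2" "\<eta> \<in> ell2" and uv: "\<And>k::nat. (u k, v k) \<in> A"
    and u: "(\<lambda>k. nrm (\<lambda>n. u k n - \<psi> n)) \<longlonglongrightarrow> 0"
    and v: "(\<lambda>k. nrm (\<lambda>n. v k n - \<eta> n)) \<longlonglongrightarrow> 0"
    unfolding op_closure_def by blast
  have ell2: "u k \<in> ell2" "v k \<in> ell2" for k using uv A by blast+
  define tail where "tail N \<phi> = (\<lambda>n. if n \<in> {n. int N \<le> \<bar>n\<bar>} then \<phi> n else (0::complex))"
    for N and \<phi> :: vec
  define cut where "cut N \<phi> = (\<lambda>n. if \<bar>n\<bar> < int N then \<phi> n else (0::complex))"
    for N and \<phi> :: vec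
  have tail_ell2: "(\<lambda>n. -1 * tail N \<phi> n) \<in> ell2" if "\<phi> \<in> ell2" for N \<phi>
    using that by (rule ell2_mono) (simp add: tail_def)
  have tail_0: "(\<lambda>N. nrm (tail N \<phi>)) \<longlonglongrightarrow> 0" if "\<phi> \<in> ell2" for \<phi>
    unfolding tail_def
  proof (rule nrm_off_decreasing_tendsto_0[OF that])
    show "decseq (\<lambda>N. {n. int N \<le> \<bar>n\<bar>})" by (auto simp: decseq_def)
    have "n \<notin> {m. int (Suc (nat \<bar>n\<bar>)) \<le> \<bar>m\<bar>}" for n by simp
    then show "(\<Inter>N. {n. int N \<le> \<bar>n\<bar>}) = {}" by blast
  qed
  \<comment> \<open>The cutoff must depend on k, because each \<open>u k\<close> and
    \<open>v k\<close> has its own rate of decay. One cutoff serves both, so that the truncated pair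
    satisfies \<open>trunc\<close>.\<close>
  have "\<exists>N. nrm (tail N (u k)) < inverse (real (Suc k)) \<and> nrm (tail N (v k)) < inverse (real (Suc k))" for k
  proof -
    have "\<forall>\<^sub>F N in sequentially. nrm (tail N (u k)) < inverse (real (Suc k))"
      "\<forall>\<^sub>F N in sequentially. nrm (tail N (v k)) < inverse (real (Suc k))"
      by (intro order_tendstoD(2)[OF tail_0] ell2; simp)+
    then have "\<forall>\<^sub>F N in sequentially. nrm (tail N (u k)) < inverse (real (Suc k))
        \<and> nrm (tail N (v k)) < inverse (real (Suc k))"
      by (rule eventually_conj)
    then show ?thesis by (rule eventually_happens'[OF sequentially_bot])
  qed
  then obtain N where N: "\<And>k. nrm (tail (N k) (u k)) < inverse (real (Suc k))"
    "\<And>k. nrm (tail (N k) (v k)) < inverse (real (Suc k))" by metis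
  have lim: "(\<lambda>k. nrm (\<lambda>n. cut (N k) (w k) n - \<phi> n)) \<longlonglongrightarrow> 0"
    if w: "\<And>k. w k \<in> ell2" "(\<lambda>k. nrm (\<lambda>n. w k n - \<phi> n)) \<longlonglongrightarrow> 0"
      and \<phi>: "\<phi> \<in> ell2" and small: "\<And>k. nrm (tail (N k) (w k)) < inverse (real (Suc k))"
    for w \<phi>
  proof (rule tendsto_sandwich[OF _ _ tendsto_const])
    show "(\<lambda>k. nrm (\<lambda>n. w k n - \<phi> n) + inverse (real (Suc k))) \<longlonglongrightarrow> 0"
      using tendsto_add[OF w(2) LIMSEQ_inverse_real_of_nat] by simp
    have "nrm (\<lambda>n. cut (N k) (w k) n - \<phi> n) \<le> nrm (\<lambda>n. w k n - \<phi> n) + inverse (real (Suc k))" for k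
    proof -
      \<comment> \<open>Cutting subtracts the tail, so the distance to the limit grows by at most
        the norm of the tail.\<close>
      have "(\<lambda>n. cut (N k) (w k) n - \<phi> n) = (\<lambda>n. (w k n - \<phi> n) + -1 * tail (N k) (w k) n)"
        by (auto simp: cut_def tail_def)
      then have "nrm (\<lambda>n. cut (N k) (w k) n - \<phi> n)
          \<le> nrm (\<lambda>n. w k n - \<phi> n) + nrm (\<lambda>n. -1 * tail (N k) (w k) n)"
        using nrm_triangle[OF ell2_diff[OF w(1) \<phi>] tail_ell2[OF w(1)], of k "N k" k] by simp
      also have "nrm (\<lambda>n. -1 * tail (N k) (w k) n) = nrm (tail (N k) (w k))"
        by (simp add: nrm_def)
      finally show ?thesis using small[of k] by linarith
    qed
    then show "\<forall>\<^sub>F k in sequentially. nrm (\<lambda>n. cut (N k) (w k) n - \<phi> n)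
        \<le> nrm (\<lambda>n. w k n - \<phi> n) + inverse (real (Suc k))" by simp
  qed (simp add: nrm_nonneg)
  have "(cut (N k) (u k), cut (N k) (v k)) \<in> B" for k
    unfolding cut_def by (rule trunc[OF uv])
  then show "(\<psi>, \<eta>) \<in> op_closure B"
    unfolding op_closure_def using \<psi> lim[OF ell2(1) u \<psi>(1) N(1)] lim[OF ell2(2) v \<psi>(2) N(2)]
    by (simp, intro exI[of _ "\<lambda>k. cut (N k) (u k)"] exI[of _ "\<lambda>k. cut (N k) (v k)"]) simp
qed

theorem mainTheorem3:
  fixes S0 \<Delta>S :: real and f :: "real \<Rightarrow> real" and \<alpha> \<beta> :: int
  assumes "S0 > 0" and "\<Delta>S > 0" and "f \<in> borel_measurable borel"
  defines "\<omega> \<equiv> freq_op S0 \<Delta>S f"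
  defines "R \<equiv> \<omega> \<alpha> \<oplus> T_op (- \<alpha>) \<cdot> \<omega> \<beta> \<cdot> T_op \<alpha>"
  shows "op_restrict (\<omega> (\<alpha> + \<beta>)) (Domain R) = R
    \<and> (\<forall>n. ket n \<in> Domain R)
    \<and> op_closure (\<omega> (\<alpha> + \<beta>)) = op_closure R"
proof -
  define g where "g n = f (S0 + of_int n * \<Delta>S)" for n
  have S: "S_op S0 \<Delta>S = mult_op (\<lambda>n. S0 + of_int n * \<Delta>S)"
    by (simp add: S_op_def mult_op_def)
  have \<omega>: "\<omega> a = mult_op g \<ominus> mult_op (\<lambda>n. g (n + a))" for a
    unfolding \<omega>_def freq_op_def S borel_calculus_mult_op[OF assms(3)] g_def[symmetric]
      shift_conjugate_mult_op ..
  \<comment> \<open>Every domain in the identity is an intersection of conditions \<open>P a\<close>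
    with a among 0, \<alpha>, \<beta> and \<alpha> + \<beta>.\<close>
  define P where "P a \<psi> \<longleftrightarrow> (\<lambda>n. complex_of_real (g (n + a)) * \<psi> n) \<in> ell2" for a \<psi>
  have \<omega>_iff: "(\<psi>, \<eta>) \<in> \<omega> a \<longleftrightarrow> \<psi> \<in> ell2 \<and> P 0 \<psi> \<and> P a \<psi> \<and>
      \<eta> = (\<lambda>n. complex_of_real (g n - g (n + a)) * \<psi> n)" for \<psi> \<eta> a
    unfolding \<omega> mult_op_diff_iff P_def by simp
  have \<omega>_ell2: "\<omega> a \<subseteq> ell2 \<times> ell2" for a
    unfolding \<omega> by (intro op_diff_ell2) (auto simp: mult_op_def)
  have conj_iff: "(\<psi>, \<eta>) \<in> T_op (- \<alpha>) \<cdot> \<omega> \<beta> \<cdot> T_op \<alpha> \<longleftrightarrow> \<psi> \<in> ell2 \<and> P \<alpha> \<psi> \<and> P (\<alpha> + \<beta>) \<psi> \<and>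
      \<eta> = (\<lambda>n. complex_of_real (g (n + \<alpha>) - g (n + \<alpha> + \<beta>)) * \<psi> n)" for \<psi> \<eta>
  proof -
    \<comment> \<open>Shifting the vector shifts the index of \<open>P\<close>: the conditions
      \<open>P 0\<close> and \<open>P \<beta>\<close> for \<open>\<omega> \<beta>\<close> become
      \<open>P \<alpha>\<close> and \<open>P (\<alpha> + \<beta>)\<close>.\<close>
    have "P a (\<lambda>n. \<psi> (n - \<alpha>)) \<longleftrightarrow> P (\<alpha> + a) \<psi>" for a
      using ell2_shift_iff[of "\<lambda>n. complex_of_real (g (n + a)) * \<psi> (n - \<alpha>)" \<alpha>]
      by (simp add: P_def algebra_simps)
    moreover have "(\<lambda>n. \<psi> (n - \<alpha>)) \<in> ell2 \<longleftrightarrow> \<psi> \<in> ell2"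
      using ell2_shift_iff[of \<psi> "- \<alpha>"] by simp
    moreover have "(\<lambda>n. \<eta> (n - \<alpha>)) = (\<lambda>n. complex_of_real (g n - g (n + \<beta>)) * \<psi> (n - \<alpha>)) \<longleftrightarrow>
        \<eta> = (\<lambda>n. complex_of_real (g (n + \<alpha>) - g (n + \<alpha> + \<beta>)) * \<psi> n)"
      unfolding fun_eq_iff by (metis add_diff_cancel_right' diff_add_cancel)
    moreover have "Range (\<omega> \<beta>) \<subseteq> ell2" using \<omega>_ell2 by blast
    ultimately show ?thesis by (simp add: shift_conjugate_iff \<omega>_iff)
  qed
  \<comment> \<open>The terms \<open>g (n + \<alpha>)\<close> cancel in the multiplier but survive
    as the condition \<open>P \<alpha>\<close>, the only difference from
    \<open>\<omega> (\<alpha> + \<beta>)\<close>.\<close>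
  have R_iff: "(\<psi>, \<eta>) \<in> R \<longleftrightarrow> \<psi> \<in> ell2 \<and> P 0 \<psi> \<and> P \<alpha> \<psi> \<and> P (\<alpha> + \<beta>) \<psi> \<and>
      \<eta> = (\<lambda>n. complex_of_real (g n - g (n + (\<alpha> + \<beta>))) * \<psi> n)" for \<psi> \<eta>
    by (auto simp: R_def op_add_def \<omega>_iff conj_iff algebra_simps)
  have R_sub: "R \<subseteq> \<omega> (\<alpha> + \<beta>)"
    by (auto simp: R_iff \<omega>_iff)
  have fin: "\<psi> \<in> ell2 \<and> P a \<psi>" if "finite {n. \<psi> n \<noteq> 0}" for \<psi> a
    unfolding P_def using that
    by (intro conjI ell2_finite_support) (auto elim: finite_subset[rotated])
  have "op_restrict (\<omega> (\<alpha> + \<beta>)) (Domain R) = R"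
    by (auto simp: op_restrict_def R_iff \<omega>_iff)
  moreover have "ket n \<in> Domain R" for n
  proof -
    have "finite {m. ket n m \<noteq> 0}"
      by (rule finite_subset[of _ "{n}"]) (auto simp: ket_def)
    from fin[OF this] show ?thesis by (auto simp: Domain_iff R_iff)
  qed
  moreover have "op_closure (\<omega> (\<alpha> + \<beta>)) = op_closure R"
  proof (rule antisym)
    show "op_closure (\<omega> (\<alpha> + \<beta>)) \<subseteq> op_closure R"
    proof (rule op_closure_subset_truncation[OF \<omega>_ell2])
      fix \<psi> \<eta> N
      assume *: "(\<psi>, \<eta>) \<in> \<omega> (\<alpha> + \<beta>)"
      \<comment> \<open>Finite support supplies the missing condition \<open>P \<alpha>\<close> for
        the truncated vector.\<close>
      have "finite {n. (if \<bar>n\<bar> < int N then \<psi> n else 0) \<noteq> 0}"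
        by (rule finite_subset[of _ "{- int N..int N}"]) auto
      from fin[OF this] * show "((\<lambda>n. if \<bar>n\<bar> < int N then \<psi> n else 0),
          (\<lambda>n. if \<bar>n\<bar> < int N then \<eta> n else 0)) \<in> R"
        unfolding R_iff \<omega>_iff by auto
    qed
  qed (rule op_closure_mono[OF R_sub])
  ultimately show ?thesis by blast
qed

end
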